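(* Let $\varphi\in C^0(\mathbb S^1,\mathbb R)$ and suppose that there exists an interval $I$ on which $\varphi$ is analytic and non-constant. For $0<\mu<1$ and integers $\lambda\ge2$ let $W_{\mu,\lambda}(\theta)=\sum_{n=0}^\infty\mu^n\varphi(\lambda^n\theta)$. Then for any $0<\mu<1$ the weak limit $$m_\mu:=\lim_{\lambda\to\infty}(W_{\mu,\lambda})_*(d\theta)$$ exists and is the distribution of $\sum_{n=0}^\infty\mu^nX_n$, where $(X_n)_{n\ge0}$ are i.i.d. random variables with distribution $\varphi_*d\theta$. Moreover, $|\widehat{m_\mu}(\xi)|\lesssim|\xi|^{-\rho}$ as $|\xi|\to\infty$ for some $\rho>0$.
   Context: $\mathbb S^1=\mathbb R/\mathbb Z$, $d\theta$ is Lebesgue probability measure on $\mathbb S^1$, $f_*d\theta$ denotes the push-forward of $d\theta$ by $f$, the limit is over integers $\lambda\to\infty$ in the sense of weak convergence of probability measures on $\mathbb R$, and $\widehat m(\xi)=\int e^{i\xi x}\,dm(x)$. *)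

theory Defs
  imports "HOL-Probability.Probability"
begin

text \<open>
  Functions on the circle \<open>\<real>/\<int>\<close> are represented by their lifts, the 1-periodic functions on the
  real line, and normalised Lebesgue measure on the circle by Lebesgue measure on the
  fundamental domain \<open>[0,1)\<close>.
\<close>

definition circle_measure :: "real measure" where
  "circle_measure = uniform_measure lborel {0..<1}"

text \<open>
  Analyticity is relative to \<open>S\<close>: the power series at \<open>x\<close> is only required to represent \<open>f\<close> at
  points of \<open>S\<close> near \<open>x\<close>. For open \<open>S\<close> this is the usual notion; at an endpoint of an interval
  \<open>S\<close> it is one-sided.
\<close>

definition real_analytic_on :: "(real \<Rightarrow> real) \<Rightarrow> real set \<Rightarrow> bool" where
  "real_analytic_on f S \<longleftrightarrow>
     (\<forall>x\<in>S. \<exists>a :: nat \<Rightarrow> real. \<exists>r>0. \<forall>y\<in>S. \<bar>y - x\<bar> < r \<longrightarrow> (\<lambda>n. a n * (y - x) ^ n) sums f y)"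

definition weierstrass_fun :: "(real \<Rightarrow> real) \<Rightarrow> real \<Rightarrow> nat \<Rightarrow> real \<Rightarrow> real" where
  "weierstrass_fun \<phi> \<mu> l \<theta> = (\<Sum>n. \<mu> ^ n * \<phi> (real l ^ n * \<theta>))"

end

theory Submission
  imports Defs "HOL-Real_Asymp.Real_Asymp"
begin

text \<open>
  For large \<open>l\<close> the numbers \<open>\<theta>, l \<theta>, l\<^sup>2 \<theta>, \<dots>\<close> are asymptotically independent and uniform on the circle:
  each of them runs through a full period while its predecessor barely moves. Averaging a slow continuous
  factor over the fibres of multiplication by \<open>l\<close> turns this into convergence of integrals of products
  (\<open>equidistribution_product\<close>). Since \<open>\<phi>\<close> is bounded, the series can be truncated with an error in the
  characteristic function that is uniform in \<open>l\<close> (\<open>char_series_truncation\<close>). Consequently the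
  characteristic functions of the Weierstrass functions converge to that of \<open>\<Sum>n. \<mu> ^ n * \<phi> (\<omega> n)\<close> with independent
  uniform coordinates \<open>\<omega> n\<close>, and Levy's continuity theorem gives the weak limit. The law of such a series is
  determined by the common marginal law (\<open>distr_iid_series\<close>).

  The characteristic function of the limit is the infinite product of the factors \<open>G (\<mu> ^ n * \<xi>)\<close>, where
  \<open>G\<close> is the characteristic function of the law of \<open>\<phi>\<close>. Analyticity enters only through a short arc on
  which \<open>\<phi>\<close> is twice continuously differentiable and \<open>\<phi>'\<close> does not vanish. Integration by parts on
  this arc shows \<open>\<bar>G\<bar> \<le> c < 1\<close> outside a bounded set (\<open>cramer_condition_analytic\<close>), and because a number
  of factors proportional to \<open>ln \<bar>\<xi>\<bar>\<close> is affected, the product decays like a negative power of \<open>\<bar>\<xi>\<bar>\<close>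
  (\<open>polynomial_decay_of_product_bound\<close>).
\<close>

section \<open>Integration on the circle\<close>
lemma prob_space_circle_measure: "prob_space circle_measure"
  unfolding circle_measure_def by (rule prob_space_uniform_measure) auto

lemma sets_circle_measure [measurable_cong, simp]: "sets circle_measure = sets borel"
  by (simp add: circle_measure_def)

lemma space_circle_measure [simp]: "space circle_measure = UNIV"
  by (simp add: circle_measure_def)

lemma AE_circle_measure: "AE t in circle_measure. t \<in> {0..<1}"
  unfolding circle_measure_def by (rule AE_uniform_measureI) auto

lemma integral_circle_measure:
  fixes f :: "real \<Rightarrow> 'a::{banach, second_countable_topology}"
  assumes [measurable]: "f \<in> borel_measurable borel"
  shows "(LINT t|circle_measure. f t) = (LINT t|lborel. indicator {0..<1} t *\<^sub>R f t)"
proof -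
  have "circle_measure = density lborel (\<lambda>t. ennreal (indicator {0..<1} t))"
    unfolding circle_measure_def uniform_measure_def by (intro density_cong) (auto split: split_indicator simp: divide_ennreal_def)
  then show ?thesis
    using assms by (subst \<open>circle_measure = _\<close>, subst integral_density) auto
qed

lemma measure_circle_measure:
  assumes "A \<in> sets borel"
  shows "measure circle_measure A = measure lborel ({0..<1} \<inter> A)"
  using assms unfolding circle_measure_def by (subst measure_uniform_measure) auto

lemma integrable_bounded:
  fixes f :: "'a \<Rightarrow> 'b::{banach, second_countable_topology}"
  assumes "prob_space M" "f \<in> borel_measurable M" "\<And>x. norm (f x) \<le> B"
  shows "integrable M f"
proof -
  interpret prob_space M by fact
  show ?thesis using assms by (intro integrable_const_bound[of _ B]) auto
qed

lemma sum_indicator_equal_parts: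
  fixes x :: real
  assumes "0 < l"
  shows "(\<Sum>j<k. indicator {real j / real l..<real (Suc j) / real l} x) = (indicator {0..<real k / real l} x :: real)"
proof (induction k)
  case (Suc k)
  have "real k / l < (1 + real k) / l" using assms by (auto simp: field_simps)
  moreover have "0 \<le> x" if "real k / l \<le> x" using that by (rule order_trans[rotated]) simp
  ultimately show ?case using Suc by (auto split: split_indicator)
qed auto

text \<open>
  The map \<open>\<theta> \<mapsto> l \<theta>\<close> preserves Haar measure on the circle, and \<open>(j + t) / l\<close> for \<open>j < l\<close> are the
  \<open>l\<close> preimages of \<open>t\<close>: an integral may be computed by averaging over each fibre first. This is what
  separates the scales in a product \<open>g \<theta> * H (l \<theta>)\<close>, since \<open>H\<close> is constant along a fibre.
\<close>
lemma integral_circle_rescale: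
  fixes F :: "real \<Rightarrow> complex" and l :: nat
  assumes l: "0 < l" and F [measurable]: "F \<in> borel_measurable borel" and B: "\<And>x. norm (F x) \<le> B"
  shows "(LINT t|circle_measure. F t) =
    (LINT t|circle_measure. (\<Sum>j<l. F ((real j + t) / real l)) /\<^sub>R real l)"
proof -
  have int: "integrable circle_measure (\<lambda>t. F ((real j + t) / real l))" for j
    by (rule integrable_bounded[OF prob_space_circle_measure _ B]) auto
  have part: "(LINT t|circle_measure. F ((real j + t) / real l)) =
      real l *\<^sub>R (LINT x|lborel. indicator {real j / real l..<real (Suc j) / real l} x *\<^sub>R F x)" (is "_ = _ *\<^sub>R ?R") for j
  proof -
    have "?R = \<bar>1 / real l\<bar> *\<^sub>R (LINT x|lborel. indicator {real j / real l..<real (Suc j) / real l} (real j / real l + 1 / real l * x)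
        *\<^sub>R F (real j / real l + 1 / real l * x))"
      using l by (intro lborel_integral_real_affine) auto
    also have "(\<lambda>x. indicator {real j / real l..<real (Suc j) / real l} (real j / real l + 1 / real l * x)
        *\<^sub>R F (real j / real l + 1 / real l * x)) = (\<lambda>x. indicator {0..<1} x *\<^sub>R F ((real j + x) / real l))"
    proof
      fix x
      have "real j / real l + 1 / real l * x = (real j + x) / real l"
        by (simp add: add_divide_distrib)
      then show "indicator {real j / real l..<real (Suc j) / real l} (real j / real l + 1 / real l * x)
        *\<^sub>R F (real j / real l + 1 / real l * x) = indicator {0..<1} x *\<^sub>R F ((real j + x) / real l)"
        using l by (simp only: indicator_def atLeastLessThan_iff) (simp add: divide_le_cancel divide_less_cancel)
    qed
    finally show ?thesis using l by (simp add: integral_circle_measure)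
  qed
  have int2: "integrable lborel (\<lambda>x. indicator {real j / real l..<real (Suc j) / real l} x *\<^sub>R F x)" for j
    by (rule integrableI_bounded_set_indicator[where B=B])
      (use B emeasure_lborel_Ico[of "real j / real l" "real (Suc j) / real l"] in \<open>auto simp: divide_right_mono\<close>)
  have "(LINT t|circle_measure. (\<Sum>j<l. F ((real j + t) / real l)) /\<^sub>R real l) =
      (\<Sum>j<l. LINT x|lborel. indicator {real j / real l..<real (Suc j) / real l} x *\<^sub>R F x)"
    using l by (simp add: int part sum_distrib_left scaleR_sum_right)
  also have "\<dots> = (LINT x|lborel. (\<Sum>j<l. indicator {real j / real l..<real (Suc j) / real l} x *\<^sub>R F x))"
    using int2 by (subst Bochner_Integration.integral_sum) auto
  also have "\<dots> = (LINT x|lborel. indicator {0..<1} x *\<^sub>R F x)"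
    using l by (simp add: scaleR_sum_left[symmetric] sum_indicator_equal_parts del: of_nat_Suc)
  also have "\<dots> = (LINT t|circle_measure. F t)"
    by (simp add: integral_circle_measure)
  finally show ?thesis ..
qed

text \<open>
  The average over the fibre above \<open>t\<close> changes by at most the modulus of continuity at scale \<open>1 / l\<close>
  when \<open>t\<close> moves inside the unit interval, and its mean over \<open>t\<close> is the integral by the previous
  lemma. Hence it is uniformly close to the integral.
\<close>
lemma riemann_sum_circle_uniform:
  fixes g :: "real \<Rightarrow> complex"
  assumes g: "continuous_on UNIV g" and B: "\<And>x. norm (g x) \<le> B" and e: "0 < e"
  shows "\<forall>\<^sub>F l in sequentially. \<forall>t\<in>{0..1}.
    norm ((\<Sum>j<l. g ((real j + t) / real l)) /\<^sub>R real l - (LINT s|circle_measure. g s)) \<le> e"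
proof -
  have [measurable]: "g \<in> borel_measurable borel" using g by (rule borel_measurable_continuous_onI)
  have "uniformly_continuous_on {0..1} g"
    by (rule compact_uniformly_continuous) (use g continuous_on_subset in auto)
  then obtain d where d: "d > 0" "\<And>x y. x \<in> {0..1} \<Longrightarrow> y \<in> {0..1} \<Longrightarrow> dist y x < d \<Longrightarrow> dist (g y) (g x) < e"
    using e unfolding uniformly_continuous_on_def by metis
  define R where "R l t = (\<Sum>j<l. g ((real j + t) / real l)) /\<^sub>R real l" for l t
  interpret prob_space circle_measure by (rule prob_space_circle_measure)
  have main: "norm (R l t - (LINT s|circle_measure. g s)) \<le> e" if l: "real l > 1 / d" "l > 0" and t: "t \<in> {0..1}" for l t
  proof -
    have close: "norm (R l t - R l s) \<le> e" if s: "s \<in> {0..1}" for s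
    proof -
      have "norm (g ((real j + t) / real l) - g ((real j + s) / real l)) \<le> e" if j: "j < l" for j
      proof -
        have jl: "real j + 1 \<le> real l" using j by linarith
        have "\<bar>t - s\<bar> \<le> 1" using s t by auto
        also have "1 < d * real l" using l d by (simp add: field_simps)
        finally have "\<bar>(t - s) / l\<bar> < d" using l by (simp add: field_simps abs_mult)
        then have "dist ((real j + t) / real l) ((real j + s) / real l) < d"
          by (simp add: dist_real_def diff_divide_distrib[symmetric])
        then have "dist (g ((real j + t) / real l)) (g ((real j + s) / real l)) < e"
          using s t jl l by (intro d) (auto simp: field_simps)
        then show ?thesis by (simp add: dist_norm)
      qed
      then have "norm (\<Sum>j<l. g ((real j + t) / real l) - g ((real j + s) / real l)) \<le> (\<Sum>j<l. e)"
        by (intro sum_norm_le) auto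
      then show ?thesis
        using l by (simp only: R_def scaleR_diff_right[symmetric] sum_subtractf[symmetric] norm_scaleR) (simp add: field_simps)
    qed
    have [measurable]: "R l \<in> borel_measurable borel" unfolding R_def by measurable
    have "norm (R l s) \<le> B" for s
    proof -
      have "norm (\<Sum>j<l. g ((real j + s) / real l)) \<le> (\<Sum>j<l. B)"
        by (intro sum_norm_le) (use B in auto)
      then show ?thesis using l by (simp add: R_def field_simps)
    qed
    then have intR: "integrable circle_measure (R l)"
      by (intro integrable_bounded[OF prob_space_circle_measure]) auto
    have "(LINT s|circle_measure. g s) = (LINT s|circle_measure. R l s)"
      unfolding R_def by (rule integral_circle_rescale) (use l B in auto)
    then have "R l t - (LINT s|circle_measure. g s) = (LINT s|circle_measure. R l t - R l s)"
      using intR by (simp add: prob_space[simplified])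
    also have "norm \<dots> \<le> (LINT s|circle_measure. norm (R l t - R l s))"
      by (rule integral_norm_bound)
    also have "\<dots> \<le> (LINT s|circle_measure. e)"
    proof (rule integral_mono_AE)
      show "AE s in circle_measure. norm (R l t - R l s) \<le> e"
        using AE_circle_measure by eventually_elim (use close in auto)
    qed (use intR in auto)
    finally show ?thesis by (simp add: prob_space[simplified])
  qed
  have "\<forall>\<^sub>F l in sequentially. real l > 1 / d" by real_asymp
  then show ?thesis using eventually_gt_at_top[of 0]
    by eventually_elim (use main in \<open>auto simp: R_def\<close>)
qed

section \<open>Asymptotic independence of the scales\<close>

text \<open>
  The induction peels off the coarsest scale: the slowest factor \<open>g 0\<close> is split off, and the remaining product is a function of \<open>l \<theta>\<close>
  with one factor less, so that averaging over fibres replaces \<open>g 0\<close> by its mean up to a vanishing error.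
\<close>
lemma equidistribution_product:
  fixes g :: "nat \<Rightarrow> real \<Rightarrow> complex"
  assumes "\<And>n. continuous_on UNIV (g n)" "\<And>n t. g n (t + 1) = g n t" "\<And>n t. norm (g n t) \<le> 1"
  shows "(\<lambda>l. LINT t|circle_measure. (\<Prod>n<N. g n (real l ^ n * t))) \<longlonglongrightarrow>
    (\<Prod>n<N. LINT t|circle_measure. g n t)"
  using assms
proof (induction N arbitrary: g)
  case 0
  interpret prob_space circle_measure by (rule prob_space_circle_measure)
  show ?case by (simp add: prob_space[simplified])
next
  case (Suc N)
  interpret prob_space circle_measure by (rule prob_space_circle_measure)
  have [measurable]: "g n \<in> borel_measurable borel" for n
    using Suc.prems(1) by (rule borel_measurable_continuous_onI)
  define H where "H l t = (\<Prod>n<N. g (Suc n) (real l ^ n * t))" for l t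
  define c where "c = (LINT t|circle_measure. g 0 t)"
  have [measurable]: "H l \<in> borel_measurable borel" for l unfolding H_def by measurable
  have norm_H: "norm (H l t) \<le> 1" for l t
    unfolding H_def prod_norm[symmetric] by (intro prod_le_1) (use Suc.prems(3) in auto)
  note per = Suc.prems(2)
  have per_nat: "g n (real k + t) = g n t" for n k t
  proof (induction k)
    case (Suc k)
    show ?case using Suc.IH per[of n "real k + t"] by (simp add: add_ac)
  qed auto
  have H_per: "H l (real j + t) = H l t" for l j t
    unfolding H_def using per_nat[of "Suc n" "l ^ n * j" "real l ^ n * t" for n] by (simp add: distrib_left)
  have intH: "integrable circle_measure (H l)" for l
    by (rule integrable_bounded[OF prob_space_circle_measure _ norm_H]) auto
  let ?F = "\<lambda>l t. \<Prod>n<Suc N. g n (real l ^ n * t)"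
  have F_eq: "?F l t = g 0 t * H l (real l * t)" for l t
    by (simp only: prod.lessThan_Suc_shift) (simp add: H_def mult_ac)
  have "(\<lambda>l. (LINT t|circle_measure. ?F l t) - c * (LINT t|circle_measure. H l t)) \<longlonglongrightarrow> 0"
  proof (rule tendstoI)
    fix e :: real assume e: "0 < e"
    have "\<forall>\<^sub>F l in sequentially. \<forall>t\<in>{0..1}.
        norm ((\<Sum>j<l. g 0 ((real j + t) / real l)) /\<^sub>R real l - (LINT s|circle_measure. g 0 s)) \<le> e / 2"
      using Suc.prems e by (intro riemann_sum_circle_uniform[where B=1]) auto
    then show "\<forall>\<^sub>F l in sequentially. dist ((LINT t|circle_measure. ?F l t) - c * (LINT t|circle_measure. H l t)) 0 < e"
      using eventually_gt_at_top[of 0]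
    proof eventually_elim
      case (elim l)
      define R where "R t = (\<Sum>j<l. g 0 ((real j + t) / real l)) /\<^sub>R real l" for t
      have [measurable]: "R \<in> borel_measurable borel" unfolding R_def by measurable
      have R: "norm (R t - c) \<le> e / 2" if "t \<in> {0..<1}" for t
        using elim(1) that unfolding R_def c_def by auto
      have norm_F: "norm (?F l t) \<le> 1" for t
        unfolding prod_norm[symmetric] by (intro prod_le_1) (use Suc.prems(3) in auto)
      have "norm (R t) \<le> 1" for t
      proof -
        have "norm (\<Sum>j<l. g 0 ((real j + t) / real l)) \<le> (\<Sum>j<l. 1)"
          by (intro sum_norm_le) (use Suc.prems(3) in auto)
        then show ?thesis using elim(2) by (simp add: R_def field_simps)
      qed
      then have int_RH: "integrable circle_measure (\<lambda>t. R t * H l t)"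
        by (intro integrable_bounded[OF prob_space_circle_measure, where B="1 * 1"])
          (auto simp: norm_mult intro!: mult_le_one norm_H)
      have "(LINT t|circle_measure. ?F l t) = (LINT t|circle_measure. (\<Sum>j<l. ?F l ((real j + t) / real l)) /\<^sub>R real l)"
        by (rule integral_circle_rescale[OF elim(2) _ norm_F]) measurable
      also have "(\<lambda>t. (\<Sum>j<l. ?F l ((real j + t) / real l)) /\<^sub>R real l) = (\<lambda>t. R t * H l t)"
        using elim(2) by (simp only: F_eq) (simp add: fun_eq_iff R_def H_per sum_distrib_right)
      finally have "(LINT t|circle_measure. ?F l t) - c * (LINT t|circle_measure. H l t) =
          (LINT t|circle_measure. (R t - c) * H l t)"
        using int_RH intH by (simp add: left_diff_distrib)
      also have "norm \<dots> \<le> (LINT t|circle_measure. norm ((R t - c) * H l t))"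
        by (rule integral_norm_bound)
      also have "\<dots> \<le> (LINT t|circle_measure. e / 2)"
      proof (rule integral_mono_AE)
        show "integrable circle_measure (\<lambda>t. norm ((R t - c) * H l t))"
          using int_RH intH by (simp add: left_diff_distrib)
        show "AE t in circle_measure. norm ((R t - c) * H l t) \<le> e / 2"
          using AE_circle_measure
        proof eventually_elim
          case (elim t)
          have "norm (R t - c) * norm (H l t) \<le> e / 2 * 1"
            using elim e by (intro mult_mono R norm_H) auto
          then show ?case by (simp add: norm_mult)
        qed
      qed auto
      also have "\<dots> < e" using e by (simp add: prob_space[simplified])
      finally show ?case by (simp only: dist_norm diff_zero)
    qed
  qed
  moreover have "(\<lambda>l. c * (LINT t|circle_measure. H l t)) \<longlonglongrightarrow> c * (\<Prod>n<N. LINT t|circle_measure. g (Suc n) t)"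
    unfolding H_def using Suc.prems by (intro tendsto_mult_left Suc.IH) auto
  ultimately have "(\<lambda>l. (LINT t|circle_measure. ?F l t) - c * (LINT t|circle_measure. H l t)
      + c * (LINT t|circle_measure. H l t)) \<longlonglongrightarrow> 0 + c * (\<Prod>n<N. LINT t|circle_measure. g (Suc n) t)"
    by (rule tendsto_add)
  then show ?case by (simp only: prod.lessThan_Suc_shift c_def) simp
qed

lemma norm_iexp_diff_le: "norm (iexp a - iexp b) \<le> \<bar>a - b\<bar>"
proof -
  have "iexp a - iexp b = iexp b * (iexp (a - b) - 1)"
    by (simp add: right_diff_distrib exp_add[symmetric] ring_distribs)
  then have "norm (iexp a - iexp b) = norm (iexp (a - b) - 1)"
    by (simp add: norm_mult)
  then show ?thesis using iexp_approx1[of "a - b" 0] by simp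
qed

lemma summable_geometric_bounded:
  fixes a :: "nat \<Rightarrow> real"
  assumes "\<And>n. \<bar>a n\<bar> \<le> B" "0 < \<mu>" "\<mu> < 1"
  shows "summable (\<lambda>n. \<mu> ^ n * a n)"
proof (rule summable_comparison_test')
  show "summable (\<lambda>n. \<mu> ^ n * B)" using assms by (intro summable_mult2 summable_geometric) auto
  show "norm (\<mu> ^ n * a n) \<le> \<mu> ^ n * B" if "n \<ge> 0" for n
    using assms by (simp add: abs_mult)
qed

lemma geometric_tail_le:
  fixes a :: "nat \<Rightarrow> real"
  assumes "\<And>n. \<bar>a n\<bar> \<le> B" "0 < \<mu>" "\<mu> < 1"
  shows "\<bar>(\<Sum>n. \<mu> ^ n * a n) - (\<Sum>n<N. \<mu> ^ n * a n)\<bar> \<le> B * \<mu> ^ N / (1 - \<mu>)"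
proof -
  have s: "(\<lambda>n. \<mu> ^ (n + N) * B) sums (1 / (1 - \<mu>) * (\<mu> ^ N * B))"
    using sums_mult2[OF geometric_sums[of \<mu>], of "\<mu> ^ N * B"] assms by (simp add: power_add mult_ac)
  have le: "norm (\<mu> ^ (n + N) * a (n + N)) \<le> \<mu> ^ (n + N) * B" for n
    using assms by (simp add: abs_mult)
  have "(\<Sum>n. \<mu> ^ n * a n) - (\<Sum>n<N. \<mu> ^ n * a n) = (\<Sum>n. \<mu> ^ (n + N) * a (n + N))"
    by (rule suminf_minus_initial_segment[OF summable_geometric_bounded[where a=a, OF assms], symmetric])
  also have "norm \<dots> \<le> (\<Sum>n. \<mu> ^ (n + N) * B)"
    using s by (intro norm_suminf_le[OF le]) (simp add: sums_iff)
  finally show ?thesis using s by (simp add: sums_iff mult_ac)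
qed

text \<open>
  The error is uniform in the random variables \<open>x n\<close>, given their common bound. This uniformity is what
  later permits exchanging the limit in the number of terms with the limit in the frequency \<open>l\<close>.
\<close>
lemma char_series_truncation:
  fixes x :: "nat \<Rightarrow> 'a \<Rightarrow> real"
  assumes P: "prob_space P" and [measurable]: "\<And>n. x n \<in> borel_measurable P"
    and B: "\<And>n \<omega>. \<bar>x n \<omega>\<bar> \<le> B" and \<mu>: "0 < \<mu>" "\<mu> < 1"
  shows "norm ((LINT \<omega>|P. iexp (\<xi> * (\<Sum>n. \<mu> ^ n * x n \<omega>))) - (LINT \<omega>|P. iexp (\<xi> * (\<Sum>n<N. \<mu> ^ n * x n \<omega>))))
    \<le> \<bar>\<xi>\<bar> * (B * \<mu> ^ N / (1 - \<mu>))" (is "norm (integral\<^sup>L P ?f - integral\<^sup>L P ?g) \<le> ?e")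
proof -
  interpret prob_space P by fact
  have int: "integrable P ?f" "integrable P ?g"
    by (rule integrable_bounded[OF P, where B=1]; simp)+
  have bound: "norm (?f \<omega> - ?g \<omega>) \<le> ?e" for \<omega>
  proof -
    have "norm (?f \<omega> - ?g \<omega>) \<le> \<bar>\<xi> * (\<Sum>n. \<mu> ^ n * x n \<omega>) - \<xi> * (\<Sum>n<N. \<mu> ^ n * x n \<omega>)\<bar>"
      by (rule norm_iexp_diff_le)
    also have "\<dots> = \<bar>\<xi>\<bar> * \<bar>(\<Sum>n. \<mu> ^ n * x n \<omega>) - (\<Sum>n<N. \<mu> ^ n * x n \<omega>)\<bar>"
      by (simp add: right_diff_distrib[symmetric] abs_mult)
    also have "\<dots> \<le> ?e" using geometric_tail_le[where a="\<lambda>n. x n \<omega>", OF B \<mu>] by (intro mult_left_mono) auto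
    finally show ?thesis .
  qed
  have "integral\<^sup>L P ?f - integral\<^sup>L P ?g = (LINT \<omega>|P. ?f \<omega> - ?g \<omega>)"
    using int by simp
  also have "norm \<dots> \<le> (LINT \<omega>|P. norm (?f \<omega> - ?g \<omega>))"
    by (rule integral_norm_bound)
  also have "\<dots> \<le> (LINT \<omega>|P. ?e)"
    by (rule integral_mono) (use int bound in auto)
  finally show ?thesis by (simp only: lebesgue_integral_const prob_space) simp
qed

section \<open>Non-stationary phase and Cramer's condition\<close>

text \<open>
  Without critical points of the phase \<open>f\<close> one can write \<open>\<i> \<eta> exp (\<i> \<eta> f)\<close> as the derivative of
  \<open>exp (\<i> \<eta> f) / f'\<close> plus \<open>exp (\<i> \<eta> f) f'' / f'\<^sup>2\<close>, both of which integrate to quantities bounded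
  independently of \<open>\<eta>\<close>.
\<close>
lemma oscillatory_integral_bound:
  fixes f f' f'' :: "real \<Rightarrow> real"
  assumes ab: "a < b"
    and f: "\<And>t. t \<in> {a..b} \<Longrightarrow> (f has_real_derivative f' t) (at t)"
    and f': "\<And>t. t \<in> {a..b} \<Longrightarrow> (f' has_real_derivative f'' t) (at t)"
    and f'': "continuous_on {a..b} f''"
    and nz: "\<And>t. t \<in> {a..b} \<Longrightarrow> f' t \<noteq> 0"
  obtains K where "\<And>\<eta>. \<bar>\<eta>\<bar> * norm (integral {a..b} (\<lambda>t. iexp (\<eta> * f t))) \<le> K"
proof -
  define u where "u t = f'' t / (f' t)\<^sup>2" for t
  have cf: "continuous_on {a..b} f"
    by (intro continuous_at_imp_continuous_on ballI) (rule DERIV_isCont[OF f])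
  have cf': "continuous_on {a..b} f'"
    by (intro continuous_at_imp_continuous_on ballI) (rule DERIV_isCont[OF f'])
  have cu: "continuous_on {a..b} u"
    unfolding u_def using nz by (intro continuous_intros cf' f'') auto
  obtain M where M: "\<And>t. t \<in> {a..b} \<Longrightarrow> \<bar>u t\<bar> \<le> M" "0 \<le> M"
  proof -
    have "bounded (u ` {a..b})" using cu by (intro compact_imp_bounded compact_continuous_image) auto
    then show thesis using that unfolding bounded_pos by (metis imageI less_imp_le real_norm_def)
  qed
  have bound: "\<bar>\<eta>\<bar> * norm (integral {a..b} (\<lambda>t. iexp (\<eta> * f t))) \<le> 1 / \<bar>f' b\<bar> + 1 / \<bar>f' a\<bar> + M * (b - a)" for \<eta>
  proof -
    define E where "E t = iexp (\<eta> * f t)" for t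
    define G where "G t = of_real (inverse (f' t)) * E t" for t
    have norm_G: "norm (G t) = 1 / \<bar>f' t\<bar>" for t
      by (simp add: G_def E_def norm_mult norm_inverse inverse_eq_divide norm_divide)
    have cE: "continuous_on {a..b} E"
      unfolding E_def by (intro continuous_intros cf)
    have cuE: "continuous_on {a..b} (\<lambda>t. of_real (u t) * E t)"
      by (intro continuous_intros cE cu)
    have dG: "(G has_vector_derivative (\<i> * of_real \<eta> * E t - of_real (u t) * E t)) (at t within {a..b})" if t: "t \<in> {a..b}" for t
    proof -
      have "((\<lambda>t. \<eta> * f t) has_vector_derivative \<eta> * f' t) (at t)"
        using f[OF t] by (auto simp: has_real_derivative_iff_has_vector_derivative[symmetric] intro!: derivative_eq_intros)
      from vector_diff_chain_at[OF this has_vector_derivative_iexp]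
      have 1: "(E has_vector_derivative (\<eta> * f' t) *\<^sub>R (\<i> * E t)) (at t)"
        by (simp add: o_def E_def[abs_def])
      have "((\<lambda>t. inverse (f' t)) has_real_derivative - u t) (at t)"
        using f'[OF t] nz[OF t] by (auto intro!: derivative_eq_intros simp: u_def power2_eq_square field_simps)
      then have 2: "((\<lambda>t. complex_of_real (inverse (f' t))) has_vector_derivative of_real (- u t)) (at t)"
        by (intro has_vector_derivative_of_real) (simp add: has_real_derivative_iff_has_vector_derivative)
      have "of_real (inverse (f' t)) * ((\<eta> * f' t) *\<^sub>R (\<i> * E t)) + of_real (- u t) * E t =
          \<i> * of_real \<eta> * E t - of_real (u t) * E t"
        using nz[OF t] by (simp add: scaleR_conv_of_real field_simps)
      then show ?thesis
        using has_vector_derivative_mult[OF 2 1] unfolding G_def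
        by (simp add: has_vector_derivative_at_within)
    qed
    have intE: "(E has_integral integral {a..b} E) {a..b}"
      using cE by (intro integrable_integral integrable_continuous_interval)
    have intuE: "((\<lambda>t. of_real (u t) * E t) has_integral integral {a..b} (\<lambda>t. of_real (u t) * E t)) {a..b}"
      using cuE by (intro integrable_integral integrable_continuous_interval)
    have "((\<lambda>t. \<i> * of_real \<eta> * E t - of_real (u t) * E t) has_integral (G b - G a)) {a..b}"
      using ab dG by (intro fundamental_theorem_of_calculus) auto
    then have "G b - G a = \<i> * of_real \<eta> * integral {a..b} E - integral {a..b} (\<lambda>t. of_real (u t) * E t)"
      by (rule has_integral_unique) (intro has_integral_diff has_integral_mult_right intE intuE)
    then have "\<i> * of_real \<eta> * integral {a..b} E = G b - G a + integral {a..b} (\<lambda>t. of_real (u t) * E t)"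
      by simp
    then have "\<bar>\<eta>\<bar> * norm (integral {a..b} E) = norm (G b - G a + integral {a..b} (\<lambda>t. of_real (u t) * E t))"
      by (metis mult_1 norm_ii norm_mult norm_of_real)
    also have "\<dots> \<le> (norm (G b) + norm (G a)) + M * measure lborel {a..b}"
    proof (intro norm_triangle_mono norm_triangle_ineq4)
      show "norm (integral {a..b} (\<lambda>t. of_real (u t) * E t)) \<le> M * measure lborel {a..b}"
        using M by (intro has_integral_bound_real[OF _ _ intuE, of _ "{}"]) (auto simp: norm_mult E_def)
    qed
    finally have "\<bar>\<eta>\<bar> * norm (integral {a..b} E) \<le> 1 / \<bar>f' b\<bar> + 1 / \<bar>f' a\<bar> + M * (b - a)"
      using ab by (simp add: norm_G)
    then show ?thesis unfolding E_def .
  qed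
  then show thesis by (rule that)
qed

text \<open>
  Cramer's condition (the characteristic function stays away from modulus 1 near infinity) follows from
  oscillation on a single short arc: its contribution tends to zero, while the rest of the circle
  contributes at most its measure \<open>1 - (b - a)\<close>.
\<close>
lemma cramer_condition_circle:
  fixes f f' f'' :: "real \<Rightarrow> real"
  assumes ab: "0 \<le> a" "a < b" "b < 1" and meas [measurable]: "f \<in> borel_measurable borel"
    and f: "\<And>t. t \<in> {a..b} \<Longrightarrow> (f has_real_derivative f' t) (at t)"
    and f': "\<And>t. t \<in> {a..b} \<Longrightarrow> (f' has_real_derivative f'' t) (at t)"
    and f'': "continuous_on {a..b} f''"
    and nz: "\<And>t. t \<in> {a..b} \<Longrightarrow> f' t \<noteq> 0"
  obtains c A where "0 < c" "c < 1" "0 < A"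
    "\<And>\<eta>. A \<le> \<bar>\<eta>\<bar> \<Longrightarrow> norm (LINT t|circle_measure. iexp (\<eta> * f t)) \<le> c"
proof -
  obtain K where K: "\<And>\<eta>. \<bar>\<eta>\<bar> * norm (integral {a..b} (\<lambda>t. iexp (\<eta> * f t))) \<le> K"
    by (rule oscillatory_integral_bound[OF ab(2) f f' f'' nz]) auto
  \<comment> \<open>For frequencies beyond \<open>A\<close> the arc contributes at most half of its length.\<close>
  define A where "A = 2 * max K 1 / (b - a)"
  define c where "c = 1 - (b - a) / 2"
  have A: "A > 0" using ab by (simp add: A_def)
  interpret prob_space circle_measure by (rule prob_space_circle_measure)
  have "norm (LINT t|circle_measure. iexp (\<eta> * f t)) \<le> c" if \<eta>: "A \<le> \<bar>\<eta>\<bar>" for \<eta>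
  proof -
    let ?E = "\<lambda>t. iexp (\<eta> * f t)"
    have int: "integrable circle_measure (\<lambda>t. indicator S t *\<^sub>R ?E t)" if [measurable]: "S \<in> sets borel" for S
      by (rule integrable_bounded[OF prob_space_circle_measure, where B=1]) (auto split: split_indicator)
    have "(\<lambda>t. ?E t) = (\<lambda>t. indicator {a..b} t *\<^sub>R ?E t + indicator (- {a..b}) t *\<^sub>R ?E t)"
      by (simp add: fun_eq_iff indicator_def)
    then have split: "(LINT t|circle_measure. ?E t) =
        (LINT t|circle_measure. indicator {a..b} t *\<^sub>R ?E t) + (LINT t|circle_measure. indicator (- {a..b}) t *\<^sub>R ?E t)"
      using Bochner_Integration.integral_add[OF int[of "{a..b}"] int[of "- {a..b}"]] by simp
    have "norm (LINT t|circle_measure. indicator {a..b} t *\<^sub>R ?E t) \<le> (b - a) / 2"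
    proof -
      have "(\<lambda>t. indicator {0..<1} t *\<^sub>R (indicator {a..b} t *\<^sub>R ?E t)) = (\<lambda>t. indicator {a..b} t *\<^sub>R ?E t)"
        using ab by (auto simp: fun_eq_iff indicator_def)
      then have "(LINT t|circle_measure. indicator {a..b} t *\<^sub>R ?E t) = (LINT t:{a..b}|lborel. ?E t)"
        unfolding set_lebesgue_integral_def by (subst integral_circle_measure) auto
      also have "\<dots> = integral {a..b} ?E"
      proof (rule set_borel_integral_eq_integral)
        show "set_integrable lborel {a..b} ?E"
          unfolding set_integrable_def
          by (rule integrableI_bounded_set_indicator[where B=1]) (use ab in auto)
      qed
      finally have eq: "(LINT t|circle_measure. indicator {a..b} t *\<^sub>R ?E t) = integral {a..b} ?E" .
      have "A * norm (integral {a..b} ?E) \<le> \<bar>\<eta>\<bar> * norm (integral {a..b} ?E)"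
        using \<eta> by (rule mult_right_mono) auto
      also have "\<dots> \<le> max K 1" using K[of \<eta>] by simp
      also have "max K 1 = A * ((b - a) / 2)" using ab by (simp add: A_def)
      finally show ?thesis using A by (simp only: eq mult_le_cancel_left_pos)
    qed
    moreover have "norm (LINT t|circle_measure. indicator (- {a..b}) t *\<^sub>R ?E t) \<le> 1 - (b - a)"
    proof -
      have "norm (LINT t|circle_measure. indicator (- {a..b}) t *\<^sub>R ?E t)
          \<le> (LINT t|circle_measure. norm (indicator (- {a..b}) t *\<^sub>R ?E t))"
        by (rule integral_norm_bound)
      also have "(\<lambda>t. norm (indicator (- {a..b}) t *\<^sub>R ?E t)) = indicator (- {a..b})"
        by (simp add: fun_eq_iff indicator_def)
      also have "(LINT t|circle_measure. indicator (- {a..b}) t) = 1 - measure circle_measure {a..b}"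
        using prob_compl[of "{a..b}"] by (simp add: Compl_eq_Diff_UNIV)
      also have "measure circle_measure {a..b} = b - a"
      proof -
        have "{0..<1} \<inter> {a..b} = {a..b}" using ab by auto
        then show ?thesis using ab by (simp add: measure_circle_measure)
      qed
      finally show ?thesis .
    qed
    ultimately have "norm (LINT t|circle_measure. ?E t) \<le> (b - a) / 2 + (1 - (b - a))"
      unfolding split by (rule norm_triangle_mono)
    then show ?thesis by (simp add: c_def field_simps)
  qed
  then show thesis using that[of c A] A ab by (auto simp: c_def)
qed

lemma power_series_derivatives:
  fixes f :: "real \<Rightarrow> real"
  assumes "\<And>y. \<bar>y - x\<bar> < r \<Longrightarrow> (\<lambda>n. a n * (y - x) ^ n) sums f y" and r: "0 < r"
  obtains f' f'' where
    "\<And>y. \<bar>y - x\<bar> < r \<Longrightarrow> (f has_real_derivative f' y) (at y)"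
    "\<And>y. \<bar>y - x\<bar> < r \<Longrightarrow> (f' has_real_derivative f'' y) (at y)"
    "\<And>y. \<bar>y - x\<bar> < r \<Longrightarrow> isCont f'' y"
    "f' x = a 1"
proof -
  define p where "p c y = (\<Sum>n. c n * (y - x) ^ n)" for c :: "nat \<Rightarrow> real" and y
  have sum0: "summable (\<lambda>n. a n * z ^ n)" if "norm z < r" for z
    using assms(1)[of "x + z"] that by (simp add: sums_iff)
  have sum1: "summable (\<lambda>n. diffs a n * z ^ n)" if "norm z < r" for z
    using that sum0 by (rule termdiff_converges)
  have sum2: "summable (\<lambda>n. diffs (diffs a) n * z ^ n)" if "norm z < r" for z
    using that sum1 by (rule termdiff_converges)
  have deriv: "(p c has_real_derivative p (diffs c) y) (at y)"
    if "\<And>z. norm z < r \<Longrightarrow> summable (\<lambda>n. c n * z ^ n)" "\<bar>y - x\<bar> < r" for c y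
  proof -
    have "((\<lambda>z. \<Sum>n. c n * z ^ n) has_real_derivative p (diffs c) y) (at (y - x))"
      unfolding p_def using that by (intro termdiffs_strong'[where K=r]) auto
    moreover have "((\<lambda>y. y - x) has_real_derivative 1) (at y)"
      by (auto intro!: derivative_eq_intros)
    ultimately have "((\<lambda>y. \<Sum>n. c n * (y - x) ^ n) has_real_derivative p (diffs c) y * 1) (at y)"
      by (rule DERIV_chain2)
    then show ?thesis by (simp add: p_def[abs_def])
  qed
  show thesis
  proof
    fix y assume y: "\<bar>y - x\<bar> < r"
    show "(f has_real_derivative p (diffs a) y) (at y)"
    proof (rule has_field_derivative_transform_within_open[OF deriv[OF sum0 y]])
      show "open {x - r <..< x + r}" by simp
      show "y \<in> {x - r <..< x + r}" using y by auto
      show "p a z = f z" if "z \<in> {x - r <..< x + r}" for z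
        using assms(1)[of z] that by (auto simp: p_def sums_iff abs_less_iff)
    qed
    show "(p (diffs a) has_real_derivative p (diffs (diffs a)) y) (at y)"
      by (rule deriv[OF sum1 y])
    show "isCont (p (diffs (diffs a))) y"
      by (rule DERIV_isCont[OF deriv[OF sum2 y]])
  next
    show "p (diffs a) x = a 1" by (simp add: p_def diffs_def)
  qed
qed

lemma periodic_of_int:
  fixes f :: "real \<Rightarrow> 'a"
  assumes "\<And>t. f (t + 1) = f t"
  shows "f (t + of_int k) = f t"
proof (induction k rule: int_induct[where k=0])
  case (step1 i)
  then show ?case using assms[of "t + of_int i"] by (simp add: add_ac)
next
  case (step2 i)
  then show ?case using assms[of "t + of_int (i - 1)"] by simp
qed simp

text \<open>
  If every expansion at an interior point had vanishing linear coefficient, then \<open>f\<close> would have zero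
  derivative on the interior of \<open>I\<close>, hence be constant there, and on all of \<open>I\<close> by continuity. At an
  interior point the expansion relative to \<open>I\<close> is an ordinary two-sided one.
\<close>
lemma analytic_nonconstant_expansion:
  fixes f :: "real \<Rightarrow> real"
  assumes cont: "continuous_on UNIV f" and I: "is_interval I"
    and an: "real_analytic_on f I" and nc: "\<not> f constant_on I"
  obtains x r a where "0 < r" "a 1 \<noteq> 0" "\<And>y. \<bar>y - x\<bar> < r \<Longrightarrow> (\<lambda>n. a n * (y - x) ^ n) sums f y"
proof (rule ccontr)
  note found = that
  assume neg: "\<not> thesis"
  have deriv0: "(f has_real_derivative 0) (at x)" if x: "x \<in> interior I" for x
  proof -
    obtain r1 where r1: "r1 > 0" "ball x r1 \<subseteq> I" using x by (meson mem_interior)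
    obtain a r2 where r2: "r2 > 0" "\<And>y. y \<in> I \<Longrightarrow> \<bar>y - x\<bar> < r2 \<Longrightarrow> (\<lambda>n. a n * (y - x) ^ n) sums f y"
      using an x interior_subset unfolding real_analytic_on_def by blast
    define r where "r = min r1 r2"
    have r: "r > 0" using r1 r2 by (simp add: r_def)
    have sums: "(\<lambda>n. a n * (y - x) ^ n) sums f y" if "\<bar>y - x\<bar> < r" for y
      using that r1(2) by (intro r2) (auto simp: r_def dist_real_def abs_minus_commute subset_iff)
    then have "a 1 = 0" using neg found[OF r] by blast
    moreover obtain f' f'' where "\<And>y. \<bar>y - x\<bar> < r \<Longrightarrow> (f has_real_derivative f' y) (at y)" "f' x = a 1"
      using power_series_derivatives[where f=f, OF sums r] by metis
    ultimately show ?thesis using r by (metis abs_zero diff_self)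
  qed
  obtain x y where xy: "x \<in> I" "y \<in> I" "x < y"
  proof -
    obtain x y where "x \<in> I" "y \<in> I" "f x \<noteq> f y" using nc unfolding constant_on_def by metis
    then show thesis using that[of x y] that[of y x] by (cases x y rule: linorder_cases) auto
  qed
  have "{x<..<y} \<subseteq> interior I"
  proof (rule interior_maximal)
    show "{x<..<y} \<subseteq> I"
      using mem_is_interval_1_I[OF I xy(1,2)] by auto
  qed simp
  moreover have "{x<..<y} \<noteq> {}" using xy by simp
  ultimately have ne: "interior I \<noteq> {}" by blast
  have conv: "convex I" using I by (rule is_interval_convex)
  obtain c where c: "\<And>x. x \<in> interior I \<Longrightarrow> f x = c"
    using has_field_derivative_zero_constant[OF convex_interior[OF conv], of f] deriv0
    by (meson has_field_derivative_at_within)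
  have "f x = c" if "x \<in> I" for x
  proof -
    have cont': "continuous_on (closure (interior I)) f" using cont continuous_on_subset by blast
    have "x \<in> closure (interior I)"
      using that convex_closure_interior[OF conv ne] closure_subset by blast
    then show ?thesis
      using continuous_constant_on_closure[where f=f and S="interior I" and a=c and x=x] cont' c by blast
  qed
  then show False using nc unfolding constant_on_def by blast
qed

text \<open>
  Next to a point where the expansion has a nonzero linear coefficient there is a short arc without
  critical points of \<open>\<phi>\<close>, and one such arc suffices.
\<close>
lemma cramer_condition_analytic:
  fixes \<phi> :: "real \<Rightarrow> real"
  assumes cont: "continuous_on UNIV \<phi>" and per: "\<And>\<theta>. \<phi> (\<theta> + 1) = \<phi> \<theta>"
    and I: "is_interval I" "real_analytic_on \<phi> I" "\<not> \<phi> constant_on I"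
  obtains c A where "0 < c" "c < 1" "0 < A"
    "\<And>\<eta>. A \<le> \<bar>\<eta>\<bar> \<Longrightarrow> norm (LINT t|circle_measure. iexp (\<eta> * \<phi> t)) \<le> c"
proof -
  obtain r a x where r: "0 < r" and a: "a 1 \<noteq> 0"
    and sums: "\<And>y. \<bar>y - x\<bar> < r \<Longrightarrow> (\<lambda>n. a n * (y - x) ^ n) sums \<phi> y"
    by (rule analytic_nonconstant_expansion[OF cont I], rule that)
  \<comment> \<open>Periodicity moves the centre into \<open>[0,1)\<close>; since it may be moved to 0, the arc extends to its right only.\<close>
  define s where "s = frac x"
  have s: "0 \<le> s" "s < 1" by (simp_all add: s_def frac_lt_1)
  have sums': "(\<lambda>n. a n * (y - s) ^ n) sums \<phi> y" if "\<bar>y - s\<bar> < r" for y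
  proof -
    have shift: "y + of_int \<lfloor>x\<rfloor> - x = y - s" by (simp add: s_def frac_def)
    show ?thesis
      using sums[of "y + of_int \<lfloor>x\<rfloor>"] that
      by (simp only: shift periodic_of_int[where f=\<phi>, OF per])
  qed
  obtain f' f'' where
    d1: "\<And>y. \<bar>y - s\<bar> < r \<Longrightarrow> (\<phi> has_real_derivative f' y) (at y)" and
    d2: "\<And>y. \<bar>y - s\<bar> < r \<Longrightarrow> (f' has_real_derivative f'' y) (at y)" and
    d3: "\<And>y. \<bar>y - s\<bar> < r \<Longrightarrow> isCont f'' y" and f's: "f' s = a 1"
    using power_series_derivatives[where f=\<phi> and x=s and r=r and a=a, OF sums' r] by metis
  have "isCont f' s" using d2[of s] r by (intro DERIV_isCont) auto
  then obtain e where e: "e > 0" "\<And>y. \<bar>y - s\<bar> < e \<Longrightarrow> f' y \<noteq> 0"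
    using continuous_at_avoid[of s f' 0] f's a by (auto simp: dist_real_def abs_minus_commute)
  define d where "d = Min {e / 2, r / 2, (1 - s) / 2}"
  define b where "b = s + d"
  have "0 < d"
    unfolding d_def using e(1) r s by (subst Min_gr_iff) auto
  moreover have "d \<le> e / 2" "d \<le> r / 2" "d \<le> (1 - s) / 2"
    unfolding d_def by (intro Min_le; blast)+
  ultimately have b: "s < b" "b < 1" "b < s + e" "b < s + r"
    using e(1) r s unfolding b_def by auto
  have near: "\<bar>t - s\<bar> < r" "\<bar>t - s\<bar> < e" if "t \<in> {s..b}" for t using that b by auto
  show thesis
  proof (rule cramer_condition_circle[where f=\<phi> and a=s and b=b and f'=f' and f''=f''])
    show "continuous_on {s..b} f''"
      using near d3 by (intro continuous_at_imp_continuous_on ballI) auto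
    show "\<phi> \<in> borel_measurable borel" using cont by (rule borel_measurable_continuous_onI)
  qed (use s b near d1 d2 e that in auto)
qed

text \<open>
  About \<open>ln (\<bar>\<xi>\<bar> / A) / \<bar>ln \<mu>\<bar>\<close> of the scaled frequencies \<open>\<mu> ^ n * \<xi>\<close> still exceed \<open>A\<close>, and each of them
  contributes a factor of at most \<open>c < 1\<close>. A geometric bound in a logarithmic number of factors is a power of
  \<open>\<bar>\<xi>\<bar>\<close>, with exponent \<open>ln c / ln \<mu>\<close>.
\<close>
lemma polynomial_decay_of_product_bound:
  fixes h G :: "real \<Rightarrow> complex"
  assumes prod: "\<And>N \<xi>. norm (h \<xi>) \<le> (\<Prod>n<N. norm (G (\<mu> ^ n * \<xi>)))"
    and G: "\<And>\<eta>. A \<le> \<bar>\<eta>\<bar> \<Longrightarrow> norm (G \<eta>) \<le> c"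
    and A: "0 < A" and c: "0 < c" "c < 1" and \<mu>: "0 < \<mu>" "\<mu> < 1"
  shows "\<exists>\<rho>>0. (\<lambda>\<xi>. norm (h \<xi>)) \<in> O[at_infinity](\<lambda>\<xi>. \<bar>\<xi>\<bar> powr (-\<rho>))"
proof -
  define \<rho> where "\<rho> = ln c / ln \<mu>"
  have ln_neg: "ln c < 0" "ln \<mu> < 0" using c \<mu> by simp_all
  have \<rho>: "\<rho> > 0" using ln_neg by (simp add: \<rho>_def divide_neg_neg)
  have bound: "norm (h \<xi>) \<le> A powr \<rho> * \<bar>\<xi>\<bar> powr (-\<rho>)" if \<xi>: "A \<le> \<bar>\<xi>\<bar>" for \<xi>
  proof -
    define L where "L = ln (\<bar>\<xi>\<bar> / A) / (- ln \<mu>)"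
    have pos: "\<bar>\<xi>\<bar> > 0" "\<bar>\<xi>\<bar> / A \<ge> 1" using \<xi> A by auto
    have L: "L \<ge> 0" unfolding L_def using pos ln_neg by (intro divide_nonneg_pos) auto
    \<comment> \<open>The indices \<open>n\<close> with \<open>A \<le> \<mu> ^ n * \<bar>\<xi>\<bar>\<close> are those up to \<open>L\<close>, including 0, hence the successor.\<close>
    define N where "N = Suc (nat \<lfloor>L\<rfloor>)"
    have N: "L \<le> real N" unfolding N_def using L by linarith
    have "norm (G (\<mu> ^ n * \<xi>)) \<le> c" if n: "n < N" for n
    proof (rule G)
      have "real n \<le> L" using n L unfolding N_def by linarith
      then have "real n * (- ln \<mu>) \<le> ln (\<bar>\<xi>\<bar> / A)"
        using ln_neg by (simp add: L_def field_simps)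
      then have "ln A \<le> ln (\<mu> ^ n * \<bar>\<xi>\<bar>)"
        using pos A \<mu> by (simp add: ln_div ln_mult ln_realpow)
      then show "A \<le> \<bar>\<mu> ^ n * \<xi>\<bar>"
        using pos A \<mu> by (simp add: abs_mult)
    qed
    then have "(\<Prod>n<N. norm (G (\<mu> ^ n * \<xi>))) \<le> (\<Prod>n<N. c)"
      by (intro prod_mono) auto
    then have "norm (h \<xi>) \<le> c ^ N" using prod[of \<xi> N] by simp
    also have "\<dots> = c powr real N" using c by (simp add: powr_realpow)
    also have "\<dots> \<le> c powr L" using N c by (intro powr_mono') auto
    also have "\<dots> = exp (-\<rho> * (ln \<bar>\<xi>\<bar> - ln A))"
      using c pos A ln_neg by (simp add: powr_def L_def \<rho>_def ln_div field_simps)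
    also have "\<dots> = A powr \<rho> * \<bar>\<xi>\<bar> powr (-\<rho>)"
      using pos A by (simp add: powr_def exp_add[symmetric] algebra_simps)
    finally show ?thesis .
  qed
  have "\<forall>\<^sub>F \<xi>::real in at_infinity. A \<le> \<bar>\<xi>\<bar>"
    unfolding eventually_at_infinity by (metis real_norm_def)
  then have "(\<lambda>\<xi>. norm (h \<xi>)) \<in> O[at_infinity](\<lambda>\<xi>. \<bar>\<xi>\<bar> powr (-\<rho>))"
    by (intro bigoI[where c="A powr \<rho>"]) (auto elim!: eventually_mono dest!: bound)
  then show ?thesis using \<rho> by blast
qed

section \<open>The limit law as an independent series\<close>

text \<open>
  Independence makes the joint law the product of the marginals, so the law of the series depends on the
  common marginal only and not on the probability space carrying the variables.
\<close>
lemma distr_iid_series: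
  fixes X :: "nat \<Rightarrow> 'a \<Rightarrow> real"
  assumes P: "prob_space P" and indep: "prob_space.indep_vars P (\<lambda>_. borel) X UNIV"
    and law: "\<And>n. distr P borel (X n) = \<nu>"
  shows "distr P borel (\<lambda>\<omega>. \<Sum>n. \<mu> ^ n * X n \<omega>) =
    distr (PiM UNIV (\<lambda>_. \<nu>)) borel (\<lambda>x. \<Sum>n. \<mu> ^ n * x n)"
proof -
  interpret prob_space P by fact
  have [measurable]: "X n \<in> borel_measurable P" for n
    using indep unfolding indep_vars_def by auto
  have "distr P (PiM UNIV (\<lambda>_. borel)) (\<lambda>\<omega>. \<lambda>n\<in>UNIV. X n \<omega>) = PiM UNIV (\<lambda>n. distr P borel (X n))"
    using indep by (subst (asm) indep_vars_iff_distr_eq_PiM) auto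
  then have "PiM UNIV (\<lambda>_. \<nu>) = distr P (PiM UNIV (\<lambda>_. borel)) (\<lambda>\<omega> n. X n \<omega>)"
    by (simp add: law restrict_def)
  then have "distr (PiM UNIV (\<lambda>_. \<nu>)) borel (\<lambda>x. \<Sum>n. \<mu> ^ n * x n) =
      distr (distr P (PiM UNIV (\<lambda>_. borel)) (\<lambda>\<omega> n. X n \<omega>)) borel (\<lambda>x. \<Sum>n. \<mu> ^ n * x n)"
    by (rule arg_cong)
  also have "\<dots> = distr P borel (\<lambda>\<omega>. \<Sum>n. \<mu> ^ n * X n \<omega>)"
  proof (subst distr_distr)
    show "(\<lambda>x. \<Sum>n. \<mu> ^ n * x n) \<in> borel_measurable (PiM UNIV (\<lambda>_. borel))"
      by measurable
    show "(\<lambda>\<omega> n. X n \<omega>) \<in> P \<rightarrow>\<^sub>M PiM UNIV (\<lambda>_. borel)"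
      using measurable_restrict[of UNIV X P "\<lambda>_. borel"] by (simp add: restrict_def)
  qed (simp add: o_def)
  finally show ?thesis ..
qed

lemma indep_vars_coordinates:
  fixes f :: "'a \<Rightarrow> 'b::topological_space"
  assumes M: "prob_space M" and [measurable]: "f \<in> borel_measurable M"
  shows "prob_space.indep_vars (PiM (UNIV :: nat set) (\<lambda>_. M)) (\<lambda>_. borel) (\<lambda>n \<omega>. f (\<omega> n)) UNIV"
proof -
  interpret prob_space "PiM (UNIV :: nat set) (\<lambda>_. M)"
    using M by (intro prob_space_PiM)
  have "indep_vars (\<lambda>_. M) (\<lambda>n \<omega>. \<omega> n) UNIV"
  proof (subst indep_vars_iff_distr_eq_PiM)
    have "distr (PiM UNIV (\<lambda>_. M)) (PiM UNIV (\<lambda>_. M)) (\<lambda>\<omega>. \<lambda>n\<in>UNIV. \<omega> n) = PiM (UNIV :: nat set) (\<lambda>_. M)"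
      by (simp add: restrict_def distr_id)
    also have "\<dots> = PiM UNIV (\<lambda>n. distr (PiM UNIV (\<lambda>_. M)) M (\<lambda>\<omega>. \<omega> n))"
      by (intro PiM_cong refl distr_PiM_component[OF M, symmetric]) auto
    finally show "distr (PiM UNIV (\<lambda>_. M)) (PiM UNIV (\<lambda>_. M)) (\<lambda>\<omega>. \<lambda>n\<in>UNIV. \<omega> n) =
      PiM UNIV (\<lambda>n::nat. distr (PiM UNIV (\<lambda>_. M)) M (\<lambda>\<omega>. \<omega> n))" .
  qed auto
  then show ?thesis by (rule indep_vars_compose2) auto
qed

lemma char_coordinates_sum:
  assumes M: "prob_space M" and [measurable]: "f \<in> borel_measurable M"
  shows "(LINT \<omega>|PiM (UNIV :: nat set) (\<lambda>_. M). iexp (\<xi> * (\<Sum>n<N. \<mu> ^ n * f (\<omega> n)))) =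
    (\<Prod>n<N. LINT t|M. iexp (\<mu> ^ n * \<xi> * f t))"
proof -
  let ?P = "PiM (UNIV :: nat set) (\<lambda>_. M)"
  interpret prob_space ?P
    using M by (intro prob_space_PiM)
  have "indep_vars (\<lambda>_. borel) (\<lambda>n \<omega>. f (\<omega> n)) {..<N}"
    using indep_vars_coordinates[OF assms] by (rule indep_vars_subset) auto
  then have indep: "indep_vars (\<lambda>_. borel) (\<lambda>n \<omega>. iexp (\<mu> ^ n * \<xi> * f (\<omega> n))) {..<N}"
    by (rule indep_vars_compose2) measurable
  have "(LINT \<omega>|?P. iexp (\<xi> * (\<Sum>n<N. \<mu> ^ n * f (\<omega> n)))) = (LINT \<omega>|?P. (\<Prod>n<N. iexp (\<mu> ^ n * \<xi> * f (\<omega> n))))"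
    by (simp add: exp_sum[symmetric] sum_distrib_left mult_ac)
  also have "\<dots> = (\<Prod>n<N. LINT \<omega>|?P. iexp (\<mu> ^ n * \<xi> * f (\<omega> n)))"
    by (rule indep_vars_lebesgue_integral[OF _ indep])
      (auto intro!: integrable_bounded[OF prob_space_axioms, where B=1])
  also have "\<dots> = (\<Prod>n<N. LINT t|M. iexp (\<mu> ^ n * \<xi> * f t))"
  proof (intro prod.cong refl)
    fix n
    have "(LINT t|M. iexp (\<mu> ^ n * \<xi> * f t)) = (LINT t|distr ?P M (\<lambda>\<omega>. \<omega> n). iexp (\<mu> ^ n * \<xi> * f t))"
      using distr_PiM_component[of UNIV "\<lambda>_::nat. M" n] M by simp
    also have "\<dots> = (LINT \<omega>|?P. iexp (\<mu> ^ n * \<xi> * f (\<omega> n)))"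
      by (intro integral_distr) measurable
    finally show "(LINT \<omega>|?P. iexp (\<mu> ^ n * \<xi> * f (\<omega> n))) = (LINT t|M. iexp (\<mu> ^ n * \<xi> * f t))" ..
  qed
  finally show ?thesis .
qed

lemma char_coordinates_series:
  fixes f :: "'a \<Rightarrow> real"
  assumes M: "prob_space M" and f [measurable]: "f \<in> borel_measurable M"
    and B: "\<And>x. \<bar>f x\<bar> \<le> B" and \<mu>: "0 < \<mu>" "\<mu> < 1"
  shows "(\<lambda>N. \<Prod>n<N. LINT t|M. iexp (\<mu> ^ n * \<xi> * f t)) \<longlonglongrightarrow>
    (LINT \<omega>|PiM (UNIV :: nat set) (\<lambda>_. M). iexp (\<xi> * (\<Sum>n. \<mu> ^ n * f (\<omega> n))))" (is "?p \<longlonglongrightarrow> ?c")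
proof -
  have P: "prob_space (PiM (UNIV :: nat set) (\<lambda>_. M))"
    using M by (intro prob_space_PiM)
  have le: "norm (?p N - ?c) \<le> \<bar>\<xi>\<bar> * (B * \<mu> ^ N / (1 - \<mu>))" for N
    using char_series_truncation[OF P, of "\<lambda>n \<omega>. f (\<omega> n)" B \<mu> \<xi> N] B \<mu>
    unfolding char_coordinates_sum[OF M f] by (simp add: norm_minus_commute)
  have "(\<lambda>N. \<bar>\<xi>\<bar> * (B * \<mu> ^ N / (1 - \<mu>))) \<longlonglongrightarrow> 0"
    using \<mu> by real_asymp
  then have "(\<lambda>N. ?p N - ?c) \<longlonglongrightarrow> 0"
    by (rule Lim_null_comparison[OF always_eventually[OF allI[OF le]]])
  then show ?thesis by (rule LIM_zero_cancel)
qed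

text \<open>
  The truncations at \<open>N\<close> terms converge as \<open>l\<close> tends to infinity by asymptotic independence of the
  scales, and they approximate the full series uniformly in \<open>l\<close>, so the two limits may be exchanged.
\<close>
lemma char_weierstrass_tendsto:
  fixes \<phi> :: "real \<Rightarrow> real"
  assumes cont: "continuous_on UNIV \<phi>" and per: "\<And>\<theta>. \<phi> (\<theta> + 1) = \<phi> \<theta>"
    and B: "\<And>x. \<bar>\<phi> x\<bar> \<le> B" and \<mu>: "0 < \<mu>" "\<mu> < 1"
  shows "(\<lambda>l. LINT t|circle_measure. iexp (\<xi> * weierstrass_fun \<phi> \<mu> l t)) \<longlonglongrightarrow>
    (LINT \<omega>|PiM (UNIV :: nat set) (\<lambda>_. circle_measure). iexp (\<xi> * (\<Sum>n. \<mu> ^ n * \<phi> (\<omega> n))))"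
proof (rule swap_uniform_limit')
  have [measurable]: "\<phi> \<in> borel_measurable borel" using cont by (rule borel_measurable_continuous_onI)
  let ?f = "\<lambda>N l. LINT t|circle_measure. iexp (\<xi> * (\<Sum>n<N. \<mu> ^ n * \<phi> (real l ^ n * t)))"
  let ?g = "\<lambda>N. \<Prod>n<N. LINT t|circle_measure. iexp (\<mu> ^ n * \<xi> * \<phi> t)"
  have "(\<lambda>l. ?f N l) \<longlonglongrightarrow> ?g N" for N
  proof -
    have "(\<lambda>l. LINT t|circle_measure. (\<Prod>n<N. iexp (\<mu> ^ n * \<xi> * \<phi> (real l ^ n * t)))) \<longlonglongrightarrow> ?g N"
      by (rule equidistribution_product[where g="\<lambda>n t. iexp (\<mu> ^ n * \<xi> * \<phi> t)"])
        (auto intro!: continuous_intros cont simp: per)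
    then show ?thesis by (simp add: exp_sum[symmetric] sum_distrib_left mult_ac)
  qed
  then show "\<forall>\<^sub>F N in sequentially. ?f N \<longlonglongrightarrow> ?g N" by simp
  show "?g \<longlonglongrightarrow> (LINT \<omega>|PiM (UNIV :: nat set) (\<lambda>_. circle_measure). iexp (\<xi> * (\<Sum>n. \<mu> ^ n * \<phi> (\<omega> n))))"
    by (rule char_coordinates_series[OF prob_space_circle_measure _ B \<mu>]) measurable
  show "uniform_limit UNIV ?f (\<lambda>l. LINT t|circle_measure. iexp (\<xi> * weierstrass_fun \<phi> \<mu> l t)) sequentially"
  proof (rule uniform_limitI)
    fix e :: real assume "e > 0"
    have "(\<lambda>N. \<bar>\<xi>\<bar> * (B * \<mu> ^ N / (1 - \<mu>))) \<longlonglongrightarrow> 0"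
      using \<mu> by real_asymp
    then have "\<forall>\<^sub>F N in sequentially. \<bar>\<xi>\<bar> * (B * \<mu> ^ N / (1 - \<mu>)) < e"
      using \<open>e > 0\<close> by (rule order_tendstoD)
    then show "\<forall>\<^sub>F N in sequentially. \<forall>l\<in>UNIV. dist (?f N l) (LINT t|circle_measure. iexp (\<xi> * weierstrass_fun \<phi> \<mu> l t)) < e"
    proof eventually_elim
      case (elim N)
      have "dist (?f N l) (LINT t|circle_measure. iexp (\<xi> * weierstrass_fun \<phi> \<mu> l t)) \<le> \<bar>\<xi>\<bar> * (B * \<mu> ^ N / (1 - \<mu>))" for l
        unfolding weierstrass_fun_def dist_norm norm_minus_commute[of "?f N l"]
        by (rule char_series_truncation[OF prob_space_circle_measure _ B \<mu>]) measurable
      then show ?case using elim by (auto intro: le_less_trans)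
    qed
  qed
qed auto

lemma periodic_continuous_bounded:
  fixes f :: "real \<Rightarrow> real"
  assumes cont: "continuous_on UNIV f" and per: "\<And>t. f (t + 1) = f t"
  shows "\<exists>B. \<forall>t. \<bar>f t\<bar> \<le> B"
proof -
  have "bounded (f ` {0..1})"
    by (intro compact_imp_bounded compact_continuous_image continuous_on_subset[OF cont]) auto
  then obtain B where "\<forall>y\<in>f ` {0..1}. norm y \<le> B"
    unfolding bounded_iff by blast
  then have B: "\<bar>f t\<bar> \<le> B" if "t \<in> {0..1}" for t
    using that by auto
  have "\<bar>f t\<bar> \<le> B" for t
  proof -
    have "f (frac t) = f t"
      using periodic_of_int[where f=f and t="frac t" and k="\<lfloor>t\<rfloor>", OF per] by (simp add: frac_def)
    then show ?thesis using B[of "frac t"] frac_lt_1[of t] by (simp add: less_imp_le)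
  qed
  then show ?thesis by blast
qed

theorem theoremC1:
  fixes \<phi> :: "real \<Rightarrow> real" and I :: "real set" and \<mu> :: real
  assumes "continuous_on UNIV \<phi>"
    and "\<And>\<theta>. \<phi> (\<theta> + 1) = \<phi> \<theta>"
    and "is_interval I"
    and "real_analytic_on \<phi> I"
    and "\<not> \<phi> constant_on I"
    and "0 < \<mu>" and "\<mu> < 1"
  shows "\<exists>m :: real measure.
    real_distribution m \<and>
    weak_conv_m (\<lambda>l. distr circle_measure borel (weierstrass_fun \<phi> \<mu> l)) m \<and>
    (\<forall>(P :: 'a measure) X.
       prob_space P \<longrightarrow>
       prob_space.indep_vars P (\<lambda>_. borel) X (UNIV :: nat set) \<longrightarrow>
       (\<forall>n. distr P borel (X n) = distr circle_measure borel \<phi>) \<longrightarrow>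
       m = distr P borel (\<lambda>\<omega>. \<Sum>n. \<mu> ^ n * X n \<omega>)) \<and>
    (\<exists>\<rho>>0. (\<lambda>\<xi>. norm (char m \<xi>)) \<in> O[at_infinity](\<lambda>\<xi>. \<bar>\<xi>\<bar> powr (-\<rho>)))"
proof -
  note \<mu> = assms(6,7)
  have meas [measurable]: "\<phi> \<in> borel_measurable borel" using assms(1) by (rule borel_measurable_continuous_onI)
  obtain B where B: "\<And>x. \<bar>\<phi> x\<bar> \<le> B" using periodic_continuous_bounded[OF assms(1,2)] by blast
  let ?\<Omega> = "PiM (UNIV :: nat set) (\<lambda>_. circle_measure)"
  let ?S = "\<lambda>\<omega>. \<Sum>n. \<mu> ^ n * \<phi> (\<omega> n)"
  define m where "m = distr ?\<Omega> borel ?S"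
  have \<Omega>: "prob_space ?\<Omega>" by (intro prob_space_PiM prob_space_circle_measure)
  interpret \<Omega>: prob_space ?\<Omega> by (rule \<Omega>)
  interpret circle: prob_space circle_measure by (rule prob_space_circle_measure)
  have S_meas [measurable]: "?S \<in> borel_measurable ?\<Omega>" by measurable
  have m: "real_distribution m" unfolding m_def by (intro \<Omega>.real_distribution_distr S_meas)
  have W_meas [measurable]: "weierstrass_fun \<phi> \<mu> l \<in> borel_measurable borel" for l
    unfolding weierstrass_fun_def[abs_def] by measurable
  have char_m: "char m \<xi> = (LINT \<omega>|?\<Omega>. iexp (\<xi> * ?S \<omega>))" for \<xi>
    unfolding m_def char_def by (subst integral_distr) auto
  have weak: "weak_conv_m (\<lambda>l. distr circle_measure borel (weierstrass_fun \<phi> \<mu> l)) m"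
  proof (rule levy_continuity[OF _ m])
    show "real_distribution (distr circle_measure borel (weierstrass_fun \<phi> \<mu> l))" for l
      by (intro circle.real_distribution_distr) simp
    show "(\<lambda>l. char (distr circle_measure borel (weierstrass_fun \<phi> \<mu> l)) \<xi>) \<longlonglongrightarrow> char m \<xi>" for \<xi>
    proof -
      have "char (distr circle_measure borel (weierstrass_fun \<phi> \<mu> l)) \<xi> =
          (LINT t|circle_measure. iexp (\<xi> * weierstrass_fun \<phi> \<mu> l t))" for l
        by (simp add: char_def integral_distr)
      then show ?thesis
        using char_weierstrass_tendsto[OF assms(1,2) B \<mu>, of \<xi>] by (simp only: char_m)
    qed
  qed
  have law: "m = distr P borel (\<lambda>\<omega>. \<Sum>n. \<mu> ^ n * X n \<omega>)"
    if "prob_space P" "prob_space.indep_vars P (\<lambda>_. borel) X (UNIV :: nat set)"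
      "\<forall>n. distr P borel (X n) = distr circle_measure borel \<phi>" for P :: "'a measure" and X
  proof -
    have "distr ?\<Omega> borel (\<lambda>\<omega>. \<phi> (\<omega> n)) = distr circle_measure borel \<phi>" for n
    proof -
      have "distr (distr ?\<Omega> circle_measure (\<lambda>\<omega>. \<omega> n)) borel \<phi> = distr ?\<Omega> borel (\<lambda>\<omega>. \<phi> (\<omega> n))"
        by (subst distr_distr) (auto simp: o_def)
      then show ?thesis using distr_PiM_component[of UNIV "\<lambda>_::nat. circle_measure" n] prob_space_circle_measure by simp
    qed
    moreover have "\<Omega>.indep_vars (\<lambda>_. borel) (\<lambda>n \<omega>. \<phi> (\<omega> n)) UNIV"
      by (rule indep_vars_coordinates[OF prob_space_circle_measure]) measurable
    ultimately have "m = distr (PiM UNIV (\<lambda>_. distr circle_measure borel \<phi>)) borel (\<lambda>x. \<Sum>n. \<mu> ^ n * x n)"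
      unfolding m_def using distr_iid_series[OF \<Omega>] by blast
    then show ?thesis using distr_iid_series[OF that(1,2)] that(3) by simp
  qed
  let ?G = "\<lambda>\<eta>. LINT t|circle_measure. iexp (\<eta> * \<phi> t)"
  obtain c A where cA: "0 < c" "c < 1" "0 < A" "\<And>\<eta>. A \<le> \<bar>\<eta>\<bar> \<Longrightarrow> norm (?G \<eta>) \<le> c"
    by (rule cramer_condition_analytic[OF assms(1-5)], rule that)
  have G_le: "norm (?G \<eta>) \<le> 1" for \<eta>
  proof -
    have "norm (?G \<eta>) \<le> (LINT t|circle_measure. norm (iexp (\<eta> * \<phi> t)))"
      by (rule integral_norm_bound)
    then show ?thesis using circle.prob_space by simp
  qed
  \<comment> \<open>All factors have modulus at most 1, so a partial product bounds the infinite one.\<close>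
  have "norm (char m \<xi>) \<le> (\<Prod>n<N. norm (?G (\<mu> ^ n * \<xi>)))" for N \<xi>
  proof (rule decseq_ge)
    show "(\<lambda>K. \<Prod>n<K. norm (?G (\<mu> ^ n * \<xi>))) \<longlonglongrightarrow> norm (char m \<xi>)"
      unfolding char_m prod_norm
      by (intro tendsto_norm char_coordinates_series[OF prob_space_circle_measure _ B \<mu>]) measurable
    show "decseq (\<lambda>K. \<Prod>n<K. norm (?G (\<mu> ^ n * \<xi>)))"
    proof (rule decseq_SucI)
      show "(\<Prod>n<Suc K. norm (?G (\<mu> ^ n * \<xi>))) \<le> (\<Prod>n<K. norm (?G (\<mu> ^ n * \<xi>)))" for K
        unfolding prod.lessThan_Suc by (intro mult_right_le_one_le prod_nonneg G_le) auto
    qed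
  qed
  then have "\<exists>\<rho>>0. (\<lambda>\<xi>. norm (char m \<xi>)) \<in> O[at_infinity](\<lambda>\<xi>. \<bar>\<xi>\<bar> powr (-\<rho>))"
    by (rule polynomial_decay_of_product_bound[OF _ cA(4,3,1,2) \<mu>])
  then show ?thesis using m weak law by blast
qed

end
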